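(* Let $1\le\ell\le m$ and $\alpha=(\alpha_1,\dots,\alpha_\ell)$ with $1\le\alpha_1<\dots<\alpha_\ell\le m$, and suppose there are integers $c,d$ with $\alpha_i=c(i-1)+d$ for $i=1,\dots,\ell$. Put $\alpha_{\ell+1}=c\ell+d=\ell\alpha_2+(1-\ell)\alpha_1$. Then the dimension $k_\alpha$ of the Schubert code $C_\alpha(\ell,m)$ is $$k_\alpha=\frac{\alpha_1}{\ell!}\prod_{i=1}^{\ell-1}(\alpha_{\ell+1}-i)=\frac{\alpha_1}{\alpha_{\ell+1}}\binom{\alpha_{\ell+1}}{\ell}.$$
   Context: $\mathbb{F}_q$ is a finite field, $V=\mathbb{F}_q^m$ with standard basis $e_1,\dots,e_m$, $A_j=\mathrm{span}(e_1,\dots,e_j)$. $G_{\ell,m}$ is the Grassmannian of $\ell$-dimensional subspaces of $V$, and $\Omega_\alpha=\{W\in G_{\ell,m}:\dim(W\cap A_{\alpha_i})\ge i,\ i=1,\dots,\ell\}$. The Schubert code $C_\alpha(\ell,m)$ is the linear code associated with the projective system of $\mathbb{F}_q$-rational points of $\Omega_\alpha$ under the Plücker embedding into $\mathbb{P}(\wedge^\ell V)$; its dimension $k_\alpha$ is the dimension of the linear span in $\wedge^\ell V$ of the Plücker images of these points. (Equivalently, $k_\alpha$ is the number of $\beta\in\mathbb{Z}^\ell$ with $1\le\beta_1<\dots<\beta_\ell\le m$ and $\beta_i\le\alpha_i$ for all $i$.) *)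

theory Defs
  imports
    "HOL-Library.Function_Algebras"
    "Jordan_Normal_Form.Determinant"
begin

text \<open>
  The dimensions \<open>m\<close> and \<open>l\<close> are numbers rather than types, so all vector spaces over the field
  \<open>'a\<close> are realised as subspaces of coordinate spaces \<open>'i \<Rightarrow> 'a\<close> with pointwise operations.
\<close>

definition fscale :: "'a::field \<Rightarrow> ('i \<Rightarrow> 'a) \<Rightarrow> 'i \<Rightarrow> 'a" where
  "fscale c v = (\<lambda>i. c * v i)"

global_interpretation fn: vector_space "fscale :: 'a::field \<Rightarrow> ('i \<Rightarrow> 'a) \<Rightarrow> 'i \<Rightarrow> 'a"
  by unfold_locales (auto simp: fscale_def fun_eq_iff algebra_simps)

definition std_basis :: "nat \<Rightarrow> nat \<Rightarrow> 'a::field" where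
  "std_basis j = (\<lambda>i. if i = j then 1 else 0)"

text \<open>\<open>flag j\<close> is \<open>A\<^sub>j\<close>; in particular \<open>flag m\<close> is \<open>V = 'a\<^sup>m\<close>, with coordinates indexed by \<open>{1..m}\<close>.\<close>

definition flag :: "nat \<Rightarrow> (nat \<Rightarrow> 'a::field) set" where
  "flag j = fn.span (std_basis ` {1..j})"

definition grassmannian :: "nat \<Rightarrow> nat \<Rightarrow> (nat \<Rightarrow> 'a::field) set set" where
  "grassmannian l m = {W. fn.subspace W \<and> W \<subseteq> flag m \<and> fn.dim W = l}"

definition schubert_variety :: "nat \<Rightarrow> nat \<Rightarrow> (nat \<Rightarrow> int) \<Rightarrow> (nat \<Rightarrow> 'a::field) set set" where
  "schubert_variety l m \<alpha> =
     {W \<in> grassmannian l m. \<forall>i\<in>{1..l}. i \<le> fn.dim (W \<inter> flag (nat (\<alpha> i)))}"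

text \<open>
  The \<open>l\<close>-th exterior power of \<open>V\<close> has the basis \<open>e\<^sub>I\<close>, where \<open>I\<close> ranges over the \<open>l\<close>-subsets of
  \<open>{1..m}\<close>. It is identified with the functions \<open>nat set \<Rightarrow> 'a\<close> supported on these \<open>I\<close>. The
  coordinate at \<open>I\<close> of \<open>w\<^sub>1 \<and> \<dots> \<and> w\<^sub>l\<close> is the minor, on the columns in \<open>I\<close>, of the matrix with rows
  \<open>w\<^sub>1, \<dots>, w\<^sub>l\<close>.
\<close>

definition wedge :: "nat \<Rightarrow> (nat \<Rightarrow> 'a::field) list \<Rightarrow> nat set \<Rightarrow> 'a" where
  "wedge m ws = (\<lambda>I. if I \<subseteq> {1..m} \<and> card I = length ws
     then det (mat (length ws) (length ws) (\<lambda>(i, j). (ws ! i) (sorted_list_of_set I ! j)))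
     else 0)"

text \<open>
  The Pluecker point of \<open>W\<close> as the set of its representing vectors. Rescaling one basis
  vector shows that, for \<open>l \<ge> 1\<close>, this is a full line with \<open>0\<close> removed.
\<close>

definition plucker_point :: "nat \<Rightarrow> (nat \<Rightarrow> 'a::field) set \<Rightarrow> (nat set \<Rightarrow> 'a) set" where
  "plucker_point m W =
     {wedge m ws | ws. distinct ws \<and> fn.independent (set ws) \<and> fn.span (set ws) = W}"

text \<open>
  The code of a projective system whose points, indexed by \<open>S\<close>, are represented by the vectors
  \<open>P s\<close>: its words are \<open>(f (P s))\<close> for linear forms \<open>f\<close>. Words are extended by \<open>0\<close> outside \<open>S\<close>.
  Taking \<open>f\<close> on the whole function space instead of on a subspace containing the \<open>P s\<close> makes no
  difference, as linear forms extend.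
\<close>

definition projective_code :: "('s \<Rightarrow> 'i \<Rightarrow> 'a::field) \<Rightarrow> 's set \<Rightarrow> ('s \<Rightarrow> 'a) set" where
  "projective_code P S =
     {(\<lambda>s. if s \<in> S then f (P s) else 0) | f. Vector_Spaces.linear fscale (*) f}"

text \<open>
  A projective system determines its code only up to rescaling coordinates; the argument \<open>P\<close> is
  the choice of a representing vector for each Pluecker point.
\<close>

definition plucker_representatives ::
    "nat \<Rightarrow> (nat \<Rightarrow> 'a::field) set set \<Rightarrow> ((nat \<Rightarrow> 'a) set \<Rightarrow> nat set \<Rightarrow> 'a) \<Rightarrow> bool" where
  "plucker_representatives m S P \<longleftrightarrow> (\<forall>W\<in>S. P W \<in> plucker_point m W)"

definition schubert_code ::
    "nat \<Rightarrow> nat \<Rightarrow> (nat \<Rightarrow> int) \<Rightarrow> ((nat \<Rightarrow> 'a::field) set \<Rightarrow> nat set \<Rightarrow> 'a) \<Rightarrow>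
     ((nat \<Rightarrow> 'a) set \<Rightarrow> 'a) set" where
  "schubert_code l m \<alpha> P = projective_code P (schubert_variety l m \<alpha>)"

end

theory Submission
  imports Defs
begin

text \<open>
  A Pluecker coordinate \<open>p\<^sub>I\<close> of \<open>W\<close> vanishes iff some nonzero vector of \<open>W\<close> vanishes on \<open>I\<close>. Hence
  \<open>p\<^sub>I\<close> is zero on the whole Schubert variety unless \<open>I\<close> meets every \<open>{1..\<alpha>\<^sub>i}\<close> in at least \<open>i\<close>
  elements, which is the condition \<open>\<beta>\<^sub>i \<le> \<alpha>\<^sub>i\<close> on the increasing enumeration \<open>\<beta>\<close> of \<open>I\<close>. For these
  \<open>I\<close> the coordinate subspace spanned by \<open>e\<^sub>i\<close> (\<open>i \<in> I\<close>) is a point of the variety with \<open>p\<^sub>I\<close> as its only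
  nonzero coordinate, so the code has dimension the number of such \<open>I\<close>. Splitting by whether the
  least possible element belongs to \<open>I\<close>, this number \<open>N(l, d)\<close> for the progression
  \<open>\<alpha>\<^sub>i = c (i - 1) + d\<close> satisfies \<open>N(l, d) = N(l, d - 1) + N(l - 1, d + c - 1)\<close> with \<open>N(l, 0) = 0\<close>,
  a recursion which the product formula satisfies as well.
\<close>

section \<open>Dimension of the code of a projective system\<close>

lemma sum_fun_apply: "(\<Sum>x\<in>A. f x) i = (\<Sum>x\<in>A. f x i)"
  for f :: "'b \<Rightarrow> 'i \<Rightarrow> 'a::comm_monoid_add"
  by (induction A rule: infinite_finite_induct) auto

lemma linear_coordinate_form:
  "Vector_Spaces.linear fscale (*) (\<lambda>v. \<Sum>i\<in>A. u i * v i)" for u :: "'i \<Rightarrow> 'a::field"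
  by unfold_locales (auto simp: fscale_def algebra_simps sum.distrib sum_distrib_left)

text \<open>The coordinate functions \<open>w i\<close> with \<open>i\<close> in \<open>B\<close>
  span the code, because the points have no other nonzero coordinates. They are independent because
  at the point \<open>q i\<close> only \<open>w i\<close> is nonzero.\<close>

lemma dim_projective_code:
  fixes P :: "'s \<Rightarrow> 'i \<Rightarrow> 'a::field"
  assumes B: "finite B"
    and supp: "\<And>s i. s \<in> S \<Longrightarrow> i \<notin> B \<Longrightarrow> P s i = 0"
    and pt: "\<And>i. i \<in> B \<Longrightarrow> q i \<in> S"
    and pt_iff: "\<And>i j. i \<in> B \<Longrightarrow> j \<in> B \<Longrightarrow> P (q i) j \<noteq> 0 \<longleftrightarrow> j = i"
  shows "fn.dim (projective_code P S) = card B"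
proof -
  define w where "w i = (\<lambda>s. if s \<in> S then P s i else 0)" for i
  have w_q: "w j (q i) \<noteq> 0 \<longleftrightarrow> j = i" if "i \<in> B" "j \<in> B" for i j
    using that pt pt_iff by (simp add: w_def)
  have inj: "inj_on w B"
    by (rule inj_onI) (metis w_q)
  have ind: "fn.independent (w ` B)"
  proof (rule fn.independent_if_scalars_zero)
    fix u x assume u: "(\<Sum>x\<in>w ` B. fscale (u x) x) = 0" and "x \<in> w ` B"
    then obtain i where i: "i \<in> B" "x = w i" by blast
    have "0 = (\<Sum>x\<in>w ` B. fscale (u x) x) (q i)"
      unfolding u by simp
    also have "\<dots> = (\<Sum>j\<in>B. u (w j) * w j (q i))"
      unfolding sum.reindex[OF inj] by (simp add: sum_fun_apply fscale_def)
    also have "\<dots> = (\<Sum>j\<in>{i}. u (w j) * w j (q i))"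
      by (rule sum.mono_neutral_right) (use B i w_q in auto)
    finally show "u x = 0" using w_q[of i i] i by simp
  qed (use B in simp)
  have "projective_code P S = fn.span (w ` B)"
  proof (rule subset_antisym; rule subsetI)
    fix x assume "x \<in> projective_code P S"
    then obtain f where f: "Vector_Spaces.linear fscale (*) f"
      and x: "x = (\<lambda>s. if s \<in> S then f (P s) else 0)"
      by (auto simp: projective_code_def)
    interpret f: Vector_Spaces.linear fscale "(*)" f by (rule f)
    \<comment> \<open>The ambient function space may be infinite-dimensional, but \<open>P s\<close>
      is a finite combination of the unit vectors \<open>e i\<close> with \<open>i\<close> in
      \<open>B\<close>, so only the values \<open>f (e i)\<close> matter.\<close>
    define e :: "'i \<Rightarrow> 'i \<Rightarrow> 'a" where "e i = (\<lambda>j. if j = i then 1 else 0)" for i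
    have "P s = (\<Sum>i\<in>B. fscale (P s i) (e i))" if "s \<in> S" for s
    proof
      fix j show "P s j = (\<Sum>i\<in>B. fscale (P s i) (e i)) j"
        using B supp[OF that, of j] by (simp add: sum_fun_apply fscale_def e_def if_distrib cong: if_cong)
    qed
    then have "f (P s) = (\<Sum>i\<in>B. P s i * f (e i))" if "s \<in> S" for s
      using that by (metis (no_types, lifting) f.scale f.sum sum.cong)
    then have "x = (\<Sum>i\<in>B. fscale (f (e i)) (w i))"
      by (auto simp: x w_def fun_eq_iff sum_fun_apply fscale_def mult.commute intro!: sum.cong)
    then show "x \<in> fn.span (w ` B)"
      by (auto intro!: fn.span_sum intro: fn.span_scale fn.span_base)
  next
    fix x assume "x \<in> fn.span (w ` B)"
    then obtain u where "x = (\<Sum>y\<in>w ` B. fscale (u y) y)"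
      using B by (auto simp: fn.span_finite)
    then have "x = (\<Sum>i\<in>B. fscale (u (w i)) (w i))"
      by (simp add: sum.reindex[OF inj])
    then have "x = (\<lambda>s. if s \<in> S then \<Sum>i\<in>B. u (w i) * P s i else 0)"
      by (auto simp: w_def fun_eq_iff sum_fun_apply fscale_def)
    then show "x \<in> projective_code P S"
      using linear_coordinate_form[of "\<lambda>i. u (w i)" B]
      by (auto simp: projective_code_def intro!: exI[of _ "\<lambda>v. \<Sum>i\<in>B. u (w i) * v i"])
  qed
  then show ?thesis
    using ind inj by (simp add: fn.dim_eq_card_independent card_image)
qed

section \<open>Coordinate subspaces and dimension bounds\<close>

lemma span_std_basis:
  assumes "finite A"
  shows "fn.span (std_basis ` A) = {w :: nat \<Rightarrow> 'a::field. \<forall>j. j \<notin> A \<longrightarrow> w j = 0}" (is "_ = ?R")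
proof (rule subset_antisym)
  show "fn.span (std_basis ` A) \<subseteq> ?R"
    by (rule fn.span_minimal) (auto simp: std_basis_def fn.subspace_def fscale_def)
  show "?R \<subseteq> fn.span (std_basis ` A)"
  proof
    fix w assume w: "w \<in> ?R"
    have "w = (\<Sum>j\<in>A. fscale (w j) (std_basis j))"
    proof
      fix i show "w i = (\<Sum>j\<in>A. fscale (w j) (std_basis j)) i"
        using assms w by (simp add: sum_fun_apply fscale_def std_basis_def if_distrib cong: if_cong)
    qed
    then show "w \<in> fn.span (std_basis ` A)"
      by (metis (no_types, lifting) fn.span_base fn.span_scale fn.span_sum imageI)
  qed
qed

lemma flag_eq: "flag a = {w :: nat \<Rightarrow> 'a::field. \<forall>j. j \<notin> {1..a} \<longrightarrow> w j = 0}"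
  unfolding flag_def by (rule span_std_basis) simp

lemma inj_std_basis: "inj (std_basis :: nat \<Rightarrow> nat \<Rightarrow> 'a::field)"
  by (rule injI) (metis std_basis_def zero_neq_one)

lemma independent_std_basis:
  assumes "finite A"
  shows "fn.independent (std_basis ` A :: (nat \<Rightarrow> 'a::field) set)"
proof
  assume "fn.dependent (std_basis ` A :: (nat \<Rightarrow> 'a) set)"
  then obtain j where j: "j \<in> A" 
    "(std_basis j :: nat \<Rightarrow> 'a) \<in> fn.span (std_basis ` A - {std_basis j})"
    by (auto simp: fn.dependent_def)
  have "std_basis ` A - {std_basis j :: nat \<Rightarrow> 'a} = std_basis ` (A - {j})"
    using inj_std_basis by (auto dest: injD)
  with j assms show False
    by (simp add: span_std_basis) (metis std_basis_def zero_neq_one)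
qed

text \<open>\<open>B\<close> extends to a maximal independent subset of \<open>U\<close>; this is
  finite because \<open>U\<close> lies in the span of the finite set \<open>T\<close>, so
  \<open>card\<close> is monotone on it.\<close>

lemma card_le_dim_of_independent:
  assumes "fn.independent B" "B \<subseteq> U" "U \<subseteq> fn.span T" "finite T"
  shows "card B \<le> fn.dim (U :: ('i \<Rightarrow> 'a::field) set)"
proof -
  obtain C where C: "B \<subseteq> C" "C \<subseteq> U" "fn.independent C" "U \<subseteq> fn.span C"
    using fn.maximal_independent_subset_extend assms(1,2) by metis
  with assms have "finite C"
    using fn.independent_span_bound by (metis order_trans)
  with C show ?thesis
    by (metis card_mono fn.basis_card_eq_dim)
qed

text \<open>Restriction to the coordinates in \<open>K\<close> maps \<open>U\<close> to a space of
  dimension \<open>card K\<close>, so it cannot be injective on \<open>U\<close>.\<close>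

lemma exists_vanishing_vector:
  fixes U :: "(nat \<Rightarrow> 'a::field) set"
  assumes U: "fn.subspace U" and K: "finite K" "card K < fn.dim U"
  shows "\<exists>u\<in>U. u \<noteq> 0 \<and> (\<forall>j\<in>K. u j = 0)"
proof (rule ccontr)
  assume none: "\<not> ?thesis"
  interpret vector_space_pair "fscale :: 'a \<Rightarrow> (nat \<Rightarrow> 'a) \<Rightarrow> _" "fscale :: 'a \<Rightarrow> (nat \<Rightarrow> 'a) \<Rightarrow> _" ..
  define r :: "(nat \<Rightarrow> 'a) \<Rightarrow> nat \<Rightarrow> 'a" where "r u = (\<lambda>j. if j \<in> K then u j else 0)" for u
  have r: "Vector_Spaces.linear fscale fscale r"
    by unfold_locales (auto simp: fscale_def r_def fun_eq_iff algebra_simps)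
  obtain B where B: "B \<subseteq> U" "fn.independent B" "U \<subseteq> fn.span B" "card B = fn.dim U"
    using fn.basis_exists by blast
  have span: "fn.span B = U"
    using B U fn.span_subspace by blast
  have inj: "inj_on r U"
  proof (rule inj_onI)
    fix u v assume uv: "u \<in> U" "v \<in> U" "r u = r v"
    then have "u j = v j" if "j \<in> K" for j
      using that by (simp add: r_def fun_eq_iff) metis
    then show "u = v"
      using none uv fn.subspace_diff[OF U, of u v] by force
  qed
  have "fn.independent (r ` B)"
    using linear_independent_injective_image[OF r B(2)] inj span by simp
  moreover have "r ` B \<subseteq> fn.span (std_basis ` K)"
    using K by (auto simp: span_std_basis r_def)
  ultimately have "card (r ` B) \<le> card (std_basis ` K :: (nat \<Rightarrow> 'a) set)"
    using fn.independent_span_bound K by blast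
  also have "\<dots> \<le> card K" using K(1) by (rule card_image_le)
  also have "card (r ` B) = card B"
    using inj B by (meson card_image inj_on_subset)
  finally show False using K B by simp
qed

section \<open>Vanishing of Pluecker coordinates\<close>

text \<open>The minor is zero iff the transposed matrix kills a nonzero vector \<open>v\<close>. The
  entries of \<open>v\<close> are the coefficients of a combination of \<open>ws\<close>, and the
  kernel condition says that this combination vanishes on \<open>I\<close>.\<close>

lemma wedge_eq_0_iff:
  fixes ws :: "(nat \<Rightarrow> 'a::field) list"
  assumes ws: "distinct ws" "fn.independent (set ws)" and I: "I \<subseteq> {1..m}" "card I = length ws"
  shows "wedge m ws I = 0 \<longleftrightarrow> (\<exists>w\<in>fn.span (set ws). w \<noteq> 0 \<and> (\<forall>j\<in>I. w j = 0))"
proof -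
  define n where "n = length ws"
  define js where "js = sorted_list_of_set I"
  define A where "A = mat n n (\<lambda>(i, j). (ws ! i) (js ! j))"
  have "finite I" using I(1) finite_subset by blast
  then have js: "set js = I" "length js = n"
    using I(2) by (auto simp: js_def n_def)
  have A: "A \<in> carrier_mat n n" by (simp add: A_def)
  define comb where "comb v = (\<Sum>i<n. fscale (v $ i) (ws ! i))" for v :: "'a vec"
  have comb_apply: "comb v j = (\<Sum>i<n. v $ i * (ws ! i) j)" for v j
    by (simp add: comb_def sum_fun_apply fscale_def)
  have vanish: "transpose_mat A *\<^sub>v v = 0\<^sub>v n \<longleftrightarrow> (\<forall>j\<in>I. comb v j = 0)" if "v \<in> carrier_vec n" for v
  proof -
    have "(transpose_mat A *\<^sub>v v) $ k = comb v (js ! k)" if "k < n" for k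
      using that \<open>v \<in> carrier_vec n\<close>
      by (auto simp: A_def comb_apply scalar_prod_def lessThan_atLeast0 mult.commute intro!: sum.cong)
    then have "transpose_mat A *\<^sub>v v = 0\<^sub>v n \<longleftrightarrow> (\<forall>k<n. comb v (js ! k) = 0)"
      using A by (auto simp: vec_eq_iff)
    also have "\<dots> \<longleftrightarrow> (\<forall>j\<in>I. comb v j = 0)"
      unfolding js(1)[symmetric] js(2)[symmetric] by (simp add: all_set_conv_all_nth)
    finally show ?thesis .
  qed
  have bij: "bij_betw ((!) ws) {..<n} (set ws)"
    using ws(1) by (simp add: bij_betw_nth n_def)
  \<comment> \<open>Independence and span concern \<open>set ws\<close>, whereas the matrix is
    indexed by positions; \<open>idx\<close> recovers the position of a vector, which is unique
    because \<open>ws\<close> is distinct.\<close>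
  define idx where "idx = the_inv_into {..<n} ((!) ws)"
  have idx: "idx (ws ! i) = i" if "i < n" for i
    using that bij by (simp add: idx_def the_inv_into_f_f bij_betw_def)
  have comb_eq: "comb v = (\<Sum>w\<in>set ws. fscale (v $ idx w) w)" for v
    unfolding comb_def sum.reindex_bij_betw[OF bij, symmetric] by (simp add: idx)
  have comb_0: "comb v = 0 \<longleftrightarrow> v = 0\<^sub>v n" if "v \<in> carrier_vec n" for v
  proof
    assume "comb v = 0"
    then have "v $ idx w = 0" if "w \<in> set ws" for w
      using fn.independentD[OF ws(2) _ subset_refl, of "\<lambda>w. v $ idx w"] that by (simp add: comb_eq)
    then have "v $ i = 0" if "i < n" for i
      using idx[OF that] that by (metis n_def nth_mem)
    then show "v = 0\<^sub>v n"
      using that by (auto simp: vec_eq_iff)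
  qed (simp add: comb_def fscale_def zero_fun_def sum_fun_apply fun_eq_iff)
  have span: "fn.span (set ws) = comb ` carrier_vec n"
  proof (rule subset_antisym; rule subsetI)
    fix w assume "w \<in> fn.span (set ws)"
    then obtain u where u: "w = (\<Sum>y\<in>set ws. fscale (u y) y)"
      by (auto simp: fn.span_finite)
    have "w = comb (vec n (\<lambda>i. u (ws ! i)))"
      unfolding u comb_def sum.reindex_bij_betw[OF bij, symmetric] by simp
    then show "w \<in> comb ` carrier_vec n" by simp
  next
    fix w assume "w \<in> comb ` carrier_vec n"
    then show "w \<in> fn.span (set ws)"
      by (auto simp: comb_eq intro!: fn.span_sum intro: fn.span_scale fn.span_base)
  qed
  have "wedge m ws I = det A"
    using I by (simp add: wedge_def A_def n_def js_def)
  also have "\<dots> = det (transpose_mat A)"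
    by (rule det_transpose[OF A, symmetric])
  finally have "wedge m ws I = det (transpose_mat A)" .
  moreover have "det (transpose_mat A) = 0 \<longleftrightarrow> (\<exists>v\<in>carrier_vec n. comb v \<noteq> 0 \<and> (\<forall>j\<in>I. comb v j = 0))"
    using det_0_iff_vec_prod_zero[of "transpose_mat A" n] A vanish comb_0 by auto
  ultimately show ?thesis
    by (simp only: span bex_simps)
qed

section \<open>Pluecker coordinates on the Schubert variety\<close>

text \<open>Counting the intersections mirrors the dimension condition of
  \<open>schubert_variety\<close> and avoids enumerating \<open>I\<close> in increasing
  order.\<close>

definition schubert_indices :: "nat \<Rightarrow> nat \<Rightarrow> (nat \<Rightarrow> int) \<Rightarrow> nat set set" where
  "schubert_indices l m \<alpha> =
     {I. I \<subseteq> {1..m} \<and> card I = l \<and> (\<forall>i\<in>{1..l}. i \<le> card (I \<inter> {1..nat (\<alpha> i)}))}"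

lemma finite_schubert_indices: "finite (schubert_indices l m \<alpha>)"
  by (rule finite_subset[of _ "Pow {1..m}"]) (auto simp: schubert_indices_def)

text \<open>If \<open>I\<close> violates the condition at \<open>i\<close>, some nonzero vector of
  \<open>W \<inter> flag (nat (\<alpha> i))\<close> vanishes at the elements of \<open>I\<close> up
  to \<open>\<alpha> i\<close>. It vanishes at the later ones because it lies in the flag.\<close>

lemma plucker_point_eq_0:
  fixes W :: "(nat \<Rightarrow> 'a::field) set"
  assumes W: "W \<in> schubert_variety l m \<alpha>" and p: "p \<in> plucker_point m W"
    and I: "I \<notin> schubert_indices l m \<alpha>"
  shows "p I = 0"
proof -
  obtain ws where ws: "p = wedge m ws" "distinct ws" "fn.independent (set ws)" "fn.span (set ws) = W"
    using p by (auto simp: plucker_point_def)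
  have "fn.dim W = length ws"
    using ws distinct_card[of ws] fn.dim_span_eq_card_independent by metis
  then have len: "length ws = l"
    using W by (simp add: schubert_variety_def grassmannian_def)
  show ?thesis
  proof (cases "I \<subseteq> {1..m} \<and> card I = l")
    case True
    then obtain i where i: "i \<in> {1..l}" "card (I \<inter> {1..nat (\<alpha> i)}) < i"
      using I by (auto simp: schubert_indices_def not_le)
    let ?U = "W \<inter> flag (nat (\<alpha> i))"
    have "card (I \<inter> {1..nat (\<alpha> i)}) < fn.dim ?U"
      using W i order.strict_trans2 by (fastforce simp: schubert_variety_def)
    moreover have "fn.subspace ?U"
      using W by (simp add: schubert_variety_def grassmannian_def flag_def fn.subspace_inter)
    ultimately obtain u where u: "u \<in> ?U" "u \<noteq> 0" "\<forall>j\<in>I \<inter> {1..nat (\<alpha> i)}. u j = 0"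
      using exists_vanishing_vector[of ?U "I \<inter> {1..nat (\<alpha> i)}"] by auto
    then have "\<forall>j\<in>I. u j = 0"
      unfolding flag_eq by blast
    then show ?thesis
      using u ws True len by (subst ws(1), subst wedge_eq_0_iff) auto
  qed (auto simp: ws(1) wedge_def len)
qed

lemma coordinate_subspace_in_schubert_variety:
  assumes "I \<in> schubert_indices l m \<alpha>"
  shows "(fn.span (std_basis ` I) :: (nat \<Rightarrow> 'a::field) set) \<in> schubert_variety l m \<alpha>"
proof -
  have I: "I \<subseteq> {1..m}" "card I = l" "\<And>i. i \<in> {1..l} \<Longrightarrow> i \<le> card (I \<inter> {1..nat (\<alpha> i)})"
    using assms by (auto simp: schubert_indices_def)
  have fin: "finite I" using I(1) finite_subset by blast
  let ?W = "fn.span (std_basis ` I) :: (nat \<Rightarrow> 'a) set"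
  have card: "card (std_basis ` J :: (nat \<Rightarrow> 'a) set) = card J" for J
    by (rule card_image[OF inj_on_subset[OF inj_std_basis subset_UNIV]])
  have "fn.dim ?W = l"
    using I(2) fin by (simp add: fn.dim_eq_card_independent independent_std_basis card)
  moreover have "?W \<subseteq> flag m"
    unfolding flag_def by (rule fn.span_mono) (use I(1) in auto)
  moreover have "i \<le> fn.dim (?W \<inter> flag (nat (\<alpha> i)))" if "i \<in> {1..l}" for i
  proof -
    let ?J = "I \<inter> {1..nat (\<alpha> i)}"
    have "card (std_basis ` ?J :: (nat \<Rightarrow> 'a) set) \<le> fn.dim (?W \<inter> flag (nat (\<alpha> i)))"
    proof (rule card_le_dim_of_independent)
      show "fn.independent (std_basis ` ?J :: (nat \<Rightarrow> 'a) set)"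
        by (rule independent_std_basis) simp
      show "std_basis ` ?J \<subseteq> ?W \<inter> flag (nat (\<alpha> i))"
        unfolding flag_def by (auto intro!: fn.span_base)
    qed (use fin in auto)
    then show ?thesis
      using I(3)[OF that] card[of ?J] by simp
  qed
  ultimately show ?thesis
    by (simp add: schubert_variety_def grassmannian_def)
qed

text \<open>The coordinate at \<open>J\<close> is zero iff some nonzero vector supported on
  \<open>I\<close> vanishes on \<open>J\<close>, that is, iff \<open>I\<close> is not contained in
  \<open>J\<close>. For sets of equal size, containment is equality.\<close>

lemma plucker_point_coordinate_subspace:
  fixes p :: "nat set \<Rightarrow> 'a::field"
  assumes p: "p \<in> plucker_point m (fn.span (std_basis ` I))"
    and I: "I \<subseteq> {1..m}" and J: "J \<subseteq> {1..m}" "card J = card I"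
  shows "p J \<noteq> 0 \<longleftrightarrow> J = I"
proof -
  have fin: "finite I" "finite J" using I J finite_subset by blast+
  obtain ws where ws: "p = wedge m ws" "distinct ws" "fn.independent (set ws)"
    "fn.span (set ws) = fn.span (std_basis ` I)"
    using p by (auto simp: plucker_point_def)
  have "length ws = fn.dim (fn.span (std_basis ` I) :: (nat \<Rightarrow> 'a) set)"
    using ws distinct_card[of ws] fn.dim_span_eq_card_independent by metis
  also have "\<dots> = card I"
    using fin(1) by (simp add: fn.dim_eq_card_independent independent_std_basis
      card_image[OF inj_on_subset[OF inj_std_basis subset_UNIV]])
  finally have len: "length ws = card I" .
  have "p J = 0 \<longleftrightarrow> (\<exists>w::nat \<Rightarrow> 'a. (\<forall>j. j \<notin> I \<longrightarrow> w j = 0) \<and> w \<noteq> 0 \<and> (\<forall>j\<in>J. w j = 0))"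
    using wedge_eq_0_iff[OF ws(2,3) J(1)] J(2) len fin
    by (simp add: ws(1,4) span_std_basis)
  also have "\<dots> \<longleftrightarrow> \<not> I \<subseteq> J"
  proof
    assume "\<not> I \<subseteq> J"
    then obtain k where k: "k \<in> I" "k \<notin> J" by blast
    then show "\<exists>w::nat \<Rightarrow> 'a. (\<forall>j. j \<notin> I \<longrightarrow> w j = 0) \<and> w \<noteq> 0 \<and> (\<forall>j\<in>J. w j = 0)"
      by (intro exI[of _ "std_basis k"]) (auto simp: std_basis_def fun_eq_iff)
  qed (auto simp: fun_eq_iff)
  also have "I \<subseteq> J \<longleftrightarrow> J = I"
    using card_subset_eq[OF fin(2)] J(2) by auto
  finally show ?thesis by simp
qed

lemma dim_schubert_code:
  fixes P :: "(nat \<Rightarrow> 'a::field) set \<Rightarrow> nat set \<Rightarrow> 'a"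
  assumes P: "plucker_representatives m (schubert_variety l m \<alpha>) P"
  shows "fn.dim (schubert_code l m \<alpha> P) = card (schubert_indices l m \<alpha>)"
  unfolding schubert_code_def
proof (rule dim_projective_code[where q = "\<lambda>I. fn.span (std_basis ` I)"])
  show "finite (schubert_indices l m \<alpha>)" by (rule finite_schubert_indices)
  show "P W I = 0" if "W \<in> schubert_variety l m \<alpha>" "I \<notin> schubert_indices l m \<alpha>" for W I
    using P that plucker_point_eq_0 by (fastforce simp: plucker_representatives_def)
  show "fn.span (std_basis ` I) \<in> schubert_variety l m \<alpha>" if "I \<in> schubert_indices l m \<alpha>" for I
    using that by (rule coordinate_subspace_in_schubert_variety)
  show "P (fn.span (std_basis ` I)) J \<noteq> 0 \<longleftrightarrow> J = I"
    if "I \<in> schubert_indices l m \<alpha>" "J \<in> schubert_indices l m \<alpha>" for I J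
  proof (rule plucker_point_coordinate_subspace)
    show "P (fn.span (std_basis ` I)) \<in> plucker_point m (fn.span (std_basis ` I))"
      using P coordinate_subspace_in_schubert_variety[OF that(1)]
      by (auto simp: plucker_representatives_def)
  qed (use that in \<open>auto simp: schubert_indices_def\<close>)
qed

section \<open>Counting the index sets by recursion\<close>

text \<open>
  The \<open>k\<close>-th smallest element of \<open>I\<close>, counting from \<open>k = 0\<close>, is less than \<open>b k\<close>; values and positions
  are thus shifted by one against \<open>schubert_indices\<close>.
\<close>

definition ballot_sets :: "nat \<Rightarrow> (nat \<Rightarrow> nat) \<Rightarrow> nat set set" where
  "ballot_sets l b = {I. finite I \<and> card I = l \<and> (\<forall>i<l. i < card (I \<inter> {..<b i}))}"

lemma ballot_sets_0: "ballot_sets 0 b = {{}}"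
  by (auto simp: ballot_sets_def)

text \<open>The condition at the last position already counts all \<open>Suc l\<close> elements.
  This confines the sets to a fixed interval and gives finiteness.\<close>

lemma ballot_sets_subset: "I \<in> ballot_sets (Suc l) b \<Longrightarrow> I \<subseteq> {..<b l}"
proof -
  assume I: "I \<in> ballot_sets (Suc l) b"
  then have "finite I" "card I \<le> card (I \<inter> {..<b l})"
    by (force simp: ballot_sets_def)+
  then have "I \<inter> {..<b l} = I"
    by (intro card_seteq) auto
  then show ?thesis by blast
qed

lemma finite_ballot_sets: "finite (ballot_sets l b)"
proof (cases l)
  case (Suc k)
  show ?thesis
    by (rule finite_subset[of _ "Pow {..<b k}"]) (use ballot_sets_subset Suc in auto)
qed (simp add: ballot_sets_0)

lemma Suc_image_Int_lessThan: "Suc ` J \<inter> {..<n} = Suc ` (J \<inter> {..<n - 1})"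
  by (cases n) auto

lemma card_Suc_image: "card (Suc ` J) = card J"
  by (simp add: card_image)

lemma Suc_image_vimage: "0 \<notin> I \<Longrightarrow> Suc ` (Suc -` I) = I"
  unfolding image_vimage_eq greaterThan_0[symmetric] by (auto intro!: gr0I)

lemma insert_0_Suc_vimage: "0 \<in> I \<Longrightarrow> insert 0 (Suc ` (Suc -` I)) = I"
  unfolding image_vimage_eq greaterThan_0[symmetric] by auto

text \<open>Shifting a set without 0 down by one lowers every bound by one. If 0 is present it is
  removed first: its own condition is \<open>b 0 > 0\<close>, and the other elements move one
  position forward, hence \<open>b (Suc i) - 1\<close>.\<close>

lemma ballot_sets_Suc:
  assumes "b 0 > 0"
  shows "ballot_sets (Suc l) b = 
    image Suc ` ballot_sets (Suc l) (\<lambda>i. b i - 1) \<union>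
    (\<lambda>J. insert 0 (Suc ` J)) ` ballot_sets l (\<lambda>i. b (Suc i) - 1)" (is "?L = ?A \<union> ?B")
proof -
  have A: "Suc ` J \<in> ?L \<longleftrightarrow> J \<in> ballot_sets (Suc l) (\<lambda>i. b i - 1)" for J
    by (auto simp: ballot_sets_def Suc_image_Int_lessThan card_Suc_image finite_image_iff)
  have B: "insert 0 (Suc ` J) \<in> ?L \<longleftrightarrow> J \<in> ballot_sets l (\<lambda>i. b (Suc i) - 1)" for J
  proof (cases "finite J")
    case True
    have *: "card (insert 0 (Suc ` J) \<inter> {..<n}) = Suc (card (J \<inter> {..<n - 1}))" if "n > 0" for n
      using that True by (simp add: Int_insert_left Suc_image_Int_lessThan card_Suc_image)
    \<comment> \<open>For \<open>n = 0\<close> both sides are false, so the truncated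
      \<open>n - 1\<close> does no harm.\<close>
    have **: "Suc i < card (insert 0 (Suc ` J) \<inter> {..<n}) \<longleftrightarrow> i < card (J \<inter> {..<n - 1})" for i n
      using *[of n] by (cases "n = 0") auto
    show ?thesis
      using True assms *[OF assms]
      by (auto simp: ballot_sets_def card_Suc_image less_Suc_eq_0_disj all_conj_distrib **)
  qed (auto simp: ballot_sets_def finite_image_iff)
  show ?thesis
  proof (rule subset_antisym; rule subsetI)
    fix I assume I: "I \<in> ?L"
    show "I \<in> ?A \<union> ?B"
    proof (cases "0 \<in> I")
      case True
      then obtain J where "I = insert 0 (Suc ` J)"
        using insert_0_Suc_vimage by metis
      with I B show ?thesis by blast
    next
      case False
      then obtain J where "I = Suc ` J"
        using Suc_image_vimage by metis
      with I A show ?thesis by blast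
    qed
  next
    fix I assume "I \<in> ?A \<union> ?B"
    then show "I \<in> ?L"
    proof
      assume "I \<in> ?A"
      then show ?thesis using A by fast
    next
      assume "I \<in> ?B"
      then show ?thesis using B by fast
    qed
  qed
qed

text \<open>\<open>vimage Suc\<close> inverts both maps of \<open>ballot_sets_Suc\<close>, and
  membership of 0 separates their images.\<close>

lemma card_ballot_sets_Suc:
  assumes "b 0 > 0"
  shows "card (ballot_sets (Suc l) b) =
    card (ballot_sets (Suc l) (\<lambda>i. b i - 1)) + card (ballot_sets l (\<lambda>i. b (Suc i) - 1))"
proof -
  have "inj (\<lambda>J. insert 0 (Suc ` J))"
    by (rule inj_on_inverseI[where g = "vimage Suc"]) auto
  moreover have "inj (image Suc)" by (rule inj_on_inverseI[where g = "vimage Suc"]) auto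
  ultimately show ?thesis
    unfolding ballot_sets_Suc[of b, OF assms]
    by (subst card_Un_disjoint)
       (auto simp: finite_ballot_sets card_image inj_on_subset)
qed

text \<open>Induction on \<open>l\<close> and, inside it, on \<open>d\<close> follows the recursion;
  for \<open>d = 0\<close> the first bound is 0 and no set is admissible. Working in the reals
  avoids truncated subtraction.\<close>

lemma card_ballot_sets_arith:
  assumes "c \<ge> 1" "l \<ge> 1"
  shows "fact l * real (card (ballot_sets l (\<lambda>i. c * i + d))) =
    real d * (\<Prod>i = 1..l - 1. real (c * l + d) - real i)"
  using \<open>l \<ge> 1\<close>
proof (induction l arbitrary: d rule: dec_induct)
  case base
  show ?case
  proof (induction d)
    case 0
    have "ballot_sets 1 ((*) c) = {}" by (auto simp: ballot_sets_def)
    then show ?case by simp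
  next
    case (Suc d)
    then show ?case
      using card_ballot_sets_Suc[of "\<lambda>i. c * i + Suc d" 0] by (simp add: ballot_sets_0)
  qed
next
  case (step l)
  define k where "k = l - 1"
  have l: "l = Suc k" using step.hyps by (simp add: k_def)
  show ?case
  proof (induction d)
    case 0
    have "ballot_sets (Suc l) ((*) c) = {}" by (auto simp: ballot_sets_def)
    then show ?case by simp
  next
    case (Suc d)
    \<comment> \<open>\<open>x\<close> is the value one step past the end of the progression of
      length \<open>Suc l\<close> starting at \<open>Suc d\<close>. For both terms of the recursion
      that value is \<open>x - 1\<close>, so they share the factor \<open>Q\<close>.\<close>
    define x where "x = real (c * Suc l + Suc d)"
    define Q where "Q = (\<Prod>i = 1..k. x - 1 - real i)"
    have 1: "real (c * l + (c + d)) = x - 1"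
      by (simp add: x_def algebra_simps)
    have 2: "real (c * Suc l + d) = x - 1"
      by (simp add: x_def algebra_simps)
    have IH: "fact l * real (card (ballot_sets l (\<lambda>i. c * i + (c + d)))) = real (c + d) * Q"
      using step.IH[of "c + d"] unfolding 1 by (simp add: Q_def l)
    have IH2: "fact (Suc l) * real (card (ballot_sets (Suc l) (\<lambda>i. c * i + d))) = 
        real d * (Q * (x - 1 - real l))"
      using Suc unfolding 2 by (simp add: Q_def l)
    have 3: "(\<Prod>i = 1..Suc l - 1. x - real i) = (x - 1) * Q"
    proof -
      have "(\<Prod>i = 1..Suc l - 1. x - real i) = (x - 1) * (\<Prod>i = Suc 1..Suc k. x - real i)"
        unfolding l by (subst prod.atLeast_Suc_atMost) simp_all
      also have "(\<Prod>i = Suc 1..Suc k. x - real i) = Q"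
        unfolding Q_def by (subst prod.shift_bounds_cl_Suc_ivl) (simp add: algebra_simps)
      finally show ?thesis .
    qed
    have "card (ballot_sets (Suc l) (\<lambda>i. c * i + Suc d)) =
        card (ballot_sets (Suc l) (\<lambda>i. c * i + d)) + card (ballot_sets l (\<lambda>i. c * i + (c + d)))"
      using card_ballot_sets_Suc[of "\<lambda>i. c * i + Suc d" l] by (simp add: algebra_simps)
    then have "fact (Suc l) * real (card (ballot_sets (Suc l) (\<lambda>i. c * i + Suc d))) =
        real d * (Q * (x - 1 - real l)) + real (Suc l) * (real (c + d) * Q)"
      unfolding IH2[symmetric] IH[symmetric] by (simp add: algebra_simps)
    \<comment> \<open>Up to the factor \<open>Q\<close> this is
      \<open>d (x - 1 - l) + (l + 1) (c + d) = (d + 1) (x - 1)\<close>, which follows from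
      \<open>x - 1 = c (l + 1) + d\<close>.\<close>
    also have "\<dots> = real (Suc d) * ((x - 1) * Q)"
      by (simp add: x_def algebra_simps)
    finally show ?case by (simp only: 3 x_def[symmetric])
  qed
qed

section \<open>The dimension formula for Schubert codes\<close>

text \<open>\<open>Suc\<close> carries sets counted from 0 to sets counted from 1. The bound by
  \<open>m\<close> is recovered from the last condition and
  \<open>\<alpha> l \<le> int m\<close>.\<close>

lemma card_schubert_indices:
  assumes "1 \<le> l" "\<alpha> l \<le> int m"
  shows "card (schubert_indices l m \<alpha>) = card (ballot_sets l (\<lambda>i. nat (\<alpha> (Suc i))))"
proof -
  let ?T = "ballot_sets l (\<lambda>i. nat (\<alpha> (Suc i)))"
  have Int: "Suc ` J \<inter> {1..n} = Suc ` (J \<inter> {..<n})" for J n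
    by auto
  have iff: "(\<forall>i\<in>{1..l}. i \<le> card (Suc ` J \<inter> {1..nat (\<alpha> i)})) \<longleftrightarrow>
      (\<forall>i<l. i < card (J \<inter> {..<nat (\<alpha> (Suc i))}))" for J
  proof -
    have "{1..l} = Suc ` {..<l}" by (simp add: image_Suc_lessThan)
    then show ?thesis
      by (simp only: ball_simps Int card_Suc_image Suc_le_eq) auto
  qed
  have "schubert_indices l m \<alpha> = image Suc ` ?T"
  proof (rule subset_antisym; rule subsetI)
    fix I assume I: "I \<in> schubert_indices l m \<alpha>"
    then have "0 \<notin> I" "finite I" by (auto simp: schubert_indices_def finite_subset)
    then obtain J where J: "I = Suc ` J" "finite J"
      by (metis Suc_image_vimage finite_imageD inj_Suc)
    with I have "J \<in> ?T"
      by (simp add: schubert_indices_def ballot_sets_def card_Suc_image iff del: One_nat_def)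
    with J show "I \<in> image Suc ` ?T" by blast
  next
    fix I assume "I \<in> image Suc ` ?T"
    then obtain J where J: "I = Suc ` J" "J \<in> ?T" by blast
    obtain k where k: "l = Suc k" using assms(1) not0_implies_Suc by fastforce
    then have "J \<subseteq> {..<nat (\<alpha> l)}"
      using J ballot_sets_subset[of J k "\<lambda>i. nat (\<alpha> (Suc i))"] by simp
    also have "\<dots> \<subseteq> {..<m}" using assms(2) by auto
    finally show "I \<in> schubert_indices l m \<alpha>"
      using J iff[of J] by (auto simp: schubert_indices_def ballot_sets_def card_Suc_image simp del: One_nat_def)
  qed
  moreover have "inj (image Suc)" 
    by (rule inj_on_inverseI[where g = "vimage Suc"]) auto
  ultimately show ?thesis
    by (simp add: card_image inj_on_subset)
qed

theorem theorem3p3: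
  fixes l m :: nat and \<alpha> :: "nat \<Rightarrow> int" and c d :: int
    and P :: "(nat \<Rightarrow> 'a::{field, finite}) set \<Rightarrow> nat set \<Rightarrow> 'a"
  assumes "1 \<le> l" and "l \<le> m"
    and "1 \<le> \<alpha> 1" and "strict_mono_on {1..l} \<alpha>" and "\<alpha> l \<le> int m"
    and "\<And>i. i \<in> {1..l} \<Longrightarrow> \<alpha> i = c * (int i - 1) + d"
    and "\<alpha> (l + 1) = c * int l + d"
    and "plucker_representatives m (schubert_variety l m \<alpha>) P"
  shows "\<alpha> (l + 1) = int l * \<alpha> 2 + (1 - int l) * \<alpha> 1
    \<and> real (fn.dim (schubert_code l m \<alpha> P)) =
          of_int (\<alpha> 1) / fact l * (\<Prod>i = 1..l - 1. of_int (\<alpha> (l + 1)) - real i)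
    \<and> (\<alpha> (l + 1) \<noteq> 0 \<longrightarrow>
         real (fn.dim (schubert_code l m \<alpha> P)) =
           of_int (\<alpha> 1) / of_int (\<alpha> (l + 1)) * (of_int (\<alpha> (l + 1)) gchoose l))"
proof -
  note arith = assms(6)
  let ?x = "real_of_int (\<alpha> (l + 1))"
  have d: "\<alpha> 1 = d" using arith[of 1] assms(1) by simp
  have \<alpha>_last: "\<alpha> (l + 1) = int l * \<alpha> 2 + (1 - int l) * \<alpha> 1"
  \<comment> \<open>For \<open>l = 1\<close> the index 2 lies outside the range of the progression
    hypothesis, but the identity then reads \<open>\<alpha> 2 = \<alpha> 2\<close>.\<close>
  proof (cases "l = 1")
    case True
    then have "l + 1 = 2" "int l = 1" by simp_all
    then show ?thesis by (simp del: One_nat_def)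
  next
    case False
    then have "\<alpha> 2 = c + d" using arith[of 2] assms(1) by simp
    then show ?thesis using d assms(7) by (simp add: algebra_simps)
  qed
  have dim: "real (fn.dim (schubert_code l m \<alpha> P)) =
      of_int (\<alpha> 1) / fact l * (\<Prod>i = 1..l - 1. ?x - real i)"
  proof -
    \<comment> \<open>For \<open>l = 1\<close> the slope \<open>c\<close> is unconstrained and irrelevant, so a positive one may be chosen.\<close>
    obtain c' where c': "c' \<ge> 1" "\<And>i. i < l \<Longrightarrow> nat (\<alpha> (Suc i)) = c' * i + nat d"
      "l \<noteq> 1 \<Longrightarrow> ?x = real (c' * l + nat d)"
    proof (cases "l = 1")
      case True
      with d show ?thesis by (intro that[of 1]) auto
    next
      case False
      then have "\<alpha> 1 < \<alpha> 2"
        using assms(1) by (intro strict_mono_onD[OF assms(4)]) auto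
      moreover have "\<alpha> 2 = c + d" using arith[of 2] assms(1) False by simp
      ultimately have "c \<ge> 1" using d by simp
      show ?thesis
      proof (rule that[of "nat c"])
        fix i assume "i < l"
        then have "\<alpha> (Suc i) = c * int i + d" using arith[of "Suc i"] by simp
        then show "nat (\<alpha> (Suc i)) = nat c * i + nat d"
          using \<open>c \<ge> 1\<close> d assms(3) by (simp add: nat_add_distrib nat_mult_distrib)
      qed (use \<open>c \<ge> 1\<close> d assms(3,7) in auto)
    qed
    have "ballot_sets l (\<lambda>i. nat (\<alpha> (Suc i))) = ballot_sets l (\<lambda>i. c' * i + nat d)"
      using c'(2) by (auto simp: ballot_sets_def)
    then have "fact l * real (fn.dim (schubert_code l m \<alpha> P)) =
        real (nat d) * (\<Prod>i = 1..l - 1. real (c' * l + nat d) - real i)"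
      using card_ballot_sets_arith[OF c'(1) assms(1), of "nat d"]
      by (simp only: dim_schubert_code[OF assms(8)] card_schubert_indices[where \<alpha> = \<alpha> and l = l, OF assms(1,5)])
    \<comment> \<open>For \<open>l = 1\<close> both products are empty, so \<open>c'\<close> need
      not reproduce \<open>\<alpha> (l + 1)\<close>.\<close>
    also have "(\<Prod>i = 1..l - 1. real (c' * l + nat d) - real i) = (\<Prod>i = 1..l - 1. ?x - real i)"
      using c'(3) by (cases "l = 1") simp_all
    finally show ?thesis
      using d assms(3) by (simp add: field_simps)
  qed
  have "fact l * (?x gchoose l) = ?x * (\<Prod>i = 1..l - 1. ?x - real i)"
  proof -
    \<comment> \<open>The factor of index 0 in the generalised binomial is \<open>?x\<close> itself;
      the others form the product of the first formula.\<close>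
    have "{0..<l} = insert 0 {1..l - 1}" using assms(1) by auto
    then show ?thesis by (simp add: gbinomial_mult_fact)
  qed
  then have "?x gchoose l = ?x * (\<Prod>i = 1..l - 1. ?x - real i) / fact l"
    by (simp add: field_simps)
  with dim have "\<alpha> (l + 1) \<noteq> 0 \<longrightarrow>
      real (fn.dim (schubert_code l m \<alpha> P)) = of_int (\<alpha> 1) / ?x * (?x gchoose l)"
    by simp
  with \<alpha>_last dim show ?thesis by blast
qed

end
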